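(* \[m_{\mathbb{H}}(xy-yx)=0,\qquad m_{\mathbb{H}}(xy-yx+1)=\frac14\Big(1-\sqrt5+3\log\frac{3+\sqrt5}{2}\Big).\]
   Context: $\mathbb{H}$ denotes the quaternions, $\mathbb{T}^2(\mathbb{H})=\{(x,y)\in\mathbb{H}^2:|x|=|y|=1\}$ with probability Haar measure $\mu$, and $m_{\mathbb{H}}(P)=\int_{\mathbb{T}^2(\mathbb{H})}\log|P(x,y)|\,d\mu$; $xy-yx$ is the quaternion commutator. *)

theory Defs
  imports "HOL-Analysis.Analysis" "HOL-Probability.Probability"
begin

text \<open>Quaternions are modelled as vectors in real^4, with components
  (a,b,c,d) = a + b i + c j + d k at indices 1,2,3,4.  The quaternion norm
  is the Euclidean norm.\<close>

type_synonym quat = "real ^ 4"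

definition qmult :: "quat \<Rightarrow> quat \<Rightarrow> quat" where
  "qmult p q = vector
     [p$1*q$1 - p$2*q$2 - p$3*q$3 - p$4*q$4,
      p$1*q$2 + p$2*q$1 + p$3*q$4 - p$4*q$3,
      p$1*q$3 - p$2*q$4 + p$3*q$1 + p$4*q$2,
      p$1*q$4 + p$2*q$3 - p$3*q$2 + p$4*q$1]"

definition qone :: quat where
  "qone = vector [1, 0, 0, 0]"

text \<open>Normalized Haar (= rotation invariant probability) measure on the unit
  quaternions S^3: push forward of the uniform distribution on the unit ball
  under radial projection.\<close>
definition sphere_haar :: "quat measure" where
  "sphere_haar = distr (uniform_measure lborel (ball 0 1)) borel (\<lambda>x. x /\<^sub>R norm x)"

definition torus_haar :: "(quat \<times> quat) measure" where
  "torus_haar = sphere_haar \<Otimes>\<^sub>M sphere_haar"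

definition mahler_H :: "(quat \<Rightarrow> quat \<Rightarrow> quat) \<Rightarrow> real" where
  "mahler_H P = integral\<^sup>L torus_haar (\<lambda>(x, y). ln (norm (P x y)))"

definition mahler_H_integrable :: "(quat \<Rightarrow> quat \<Rightarrow> quat) \<Rightarrow> bool" where
  "mahler_H_integrable P = integrable torus_haar (\<lambda>(x, y). ln (norm (P x y)))"

end

theory Submission
  imports Defs "HOL-Real_Asymp.Real_Asymp"
begin

text \<open>
  Write $u, v$ for the imaginary parts of $x, y$. Then $|xy - yx|^2 = 4 |u \times v|^2 =: W$ and
  $|xy - yx + 1|^2 = 1 + W$. Two coordinates of a uniform point of $S^3$ are uniform on the unit disc.
  For fixed $x$, rotating $u$ onto a coordinate axis turns $|u \times v|^2$ into $|u|^2$ times the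
  squared length of two coordinates of $y$, so $W$ is distributed as $4 |u|^2 T$ with $T$ uniform on
  $[0,1]$; and $|u|^2 = \sin^2 t$ with $t$ of density $\frac{2}{\pi} \sin^2 t$ on $[0, \pi]$. Taking
  the expectation of $\ln (e + W)$ leaves an integral of $K \ln K$ with $K = e + 4 \sin^2 t$. For
  $e = (1 - a)^2 / a$ one has $a K = 1 - 2 a \cos 2t + a^2$, whose logarithm has the Fourier
  coefficients $- 2 a^n / n$, so only $n = 1$ contributes. The value $e = 1$, that is
  $a = (3 - \sqrt 5) / 2$, is the second claim; the first follows by monotone convergence as
  $a \to 1$, $e \to 0$.
\<close>

subsection \<open>Coordinates of a uniform point of the unit sphere\<close>

lemma Basis_quat: "(Basis :: quat set) = {axis 1 1, axis 2 1, axis 3 1, axis 4 1}"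
  by (auto simp: Basis_vec_def UNIV_4)

lemma prod_Basis_quat: "(\<Prod>b\<in>Basis. f (b :: quat)) = f (axis 1 1) * f (axis 2 1) * f (axis 3 1) * f (axis 4 1)"
  by (simp add: Basis_quat axis_eq_axis mult.assoc)

lemma prod_Basis_R2: "(\<Prod>b\<in>Basis. f (b :: real \<times> real)) = f (1, 0) * f (0, 1)"
  by (simp add: Basis_prod_def mult.commute)

lemma vector_4 [simp]:
  "(vector [a, b, c, d] :: 'a::zero ^ 4) $ 1 = a"
  "(vector [a, b, c, d] :: 'a ^ 4) $ 2 = b"
  "(vector [a, b, c, d] :: 'a ^ 4) $ 3 = c"
  "(vector [a, b, c, d] :: 'a ^ 4) $ 4 = d"
  unfolding vector_def by auto

lemma measurable_vec_nth [measurable]: "(\<lambda>x. x $ i) \<in> borel_measurable (borel :: (real ^ 'n) measure)"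
  by (intro borel_measurable_continuous_onI continuous_intros)

lemma measurable_vector_4 [measurable]:
  assumes [measurable]: "f \<in> borel_measurable M" "g \<in> borel_measurable M" "h \<in> borel_measurable M" "k \<in> borel_measurable M"
  shows "(\<lambda>x. vector [f x, g x, h x, k x] :: quat) \<in> borel_measurable M"
proof (rule borel_measurable_euclidean_space[THEN iffD2], rule ballI)
  fix b :: quat assume "b \<in> Basis"
  then show "(\<lambda>x. vector [f x, g x, h x, k x] \<bullet> b) \<in> borel_measurable M"
    by (auto simp: Basis_quat inner_axis vector_4)
qed

lemma norm_quat_sq: "(norm (x :: quat))\<^sup>2 = (x$1)\<^sup>2 + (x$2)\<^sup>2 + (x$3)\<^sup>2 + (x$4)\<^sup>2"
  by (simp add: power2_norm_eq_inner inner_vec_def sum_4) (simp add: power2_eq_square)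

text \<open>The first pair is put into coordinates 2 and 3, away from the real part, so that the rotation
  of the imaginary part can fix coordinate 1.\<close>
definition quat_of_pairs :: "(real \<times> real) \<times> (real \<times> real) \<Rightarrow> quat" where
  "quat_of_pairs p = vector [fst (snd p), fst (fst p), snd (fst p), snd (snd p)]"

lemma measurable_quat_of_pairs [measurable]: "quat_of_pairs \<in> borel_measurable (borel \<Otimes>\<^sub>M borel)"
  unfolding quat_of_pairs_def borel_prod
  by (intro measurable_vector_4 borel_measurable_continuous_onI continuous_intros)

lemma box_quat_of_pairs:
  "quat_of_pairs -` box l u = box (l$2, l$3) (u$2, u$3) \<times> box (l$1, l$4) (u$1, u$4)"
  by (auto simp: quat_of_pairs_def mem_box mem_box_cart[where 'n=4] forall_4 Basis_prod_def Basis_quat inner_axis)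

text \<open>Lebesgue measure is determined by its values on boxes, and the preimage of a box is a
  product of two planar boxes, whose areas multiply to the volume.\<close>

lemma lborel_quat: "(lborel :: quat measure) = distr (lborel \<Otimes>\<^sub>M lborel) borel quat_of_pairs"
proof (rule lborel_eqI)
  fix l u :: quat assume le: "\<And>b. b \<in> Basis \<Longrightarrow> l \<bullet> b \<le> u \<bullet> b"
  have le': "l$1 \<le> u$1" "l$2 \<le> u$2" "l$3 \<le> u$3" "l$4 \<le> u$4"
    using le[of "axis 1 1"] le[of "axis 2 1"] le[of "axis 3 1"] le[of "axis 4 1"]
    by (auto simp: Basis_quat inner_axis)
  have "emeasure (distr (lborel \<Otimes>\<^sub>M lborel) borel quat_of_pairs) (box l u)
      = emeasure (lborel \<Otimes>\<^sub>M lborel) (box (l$2, l$3) (u$2, u$3) \<times> box (l$1, l$4) (u$1, u$4))"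
    by (subst emeasure_distr) (simp_all add: box_quat_of_pairs space_pair_measure)
  also have "\<dots> = emeasure lborel (box (l$2, l$3) (u$2, u$3)) * emeasure lborel (box (l$1, l$4) (u$1, u$4))"
    by (intro lborel.emeasure_pair_measure_Times) auto
  also have "\<dots> = ennreal ((u$2 - l$2) * (u$3 - l$3)) * ennreal ((u$1 - l$1) * (u$4 - l$4))"
    using le' by (subst (1 2) emeasure_lborel_box) (auto simp: prod_Basis_R2 Basis_prod_def mult.commute)
  also have "\<dots> = ennreal (\<Prod>b\<in>Basis. (u - l) \<bullet> b)"
    using le' by (simp add: prod_Basis_quat inner_axis ennreal_mult[symmetric] ac_simps)
  finally show "emeasure (distr (lborel \<Otimes>\<^sub>M lborel) borel quat_of_pairs) (box l u)
      = (\<Prod>b\<in>Basis. (u - l) \<bullet> b)" .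
qed simp

lemma nn_integral_quat:
  assumes [measurable]: "f \<in> borel_measurable (borel :: quat measure)"
  shows "(\<integral>\<^sup>+x. f x \<partial>lborel) = (\<integral>\<^sup>+z. \<integral>\<^sup>+w. f (quat_of_pairs (z, w)) \<partial>lborel \<partial>lborel)"
proof -
  have "(\<integral>\<^sup>+x. f x \<partial>lborel) = (\<integral>\<^sup>+p. f (quat_of_pairs p) \<partial>(lborel \<Otimes>\<^sub>M lborel))"
    by (subst lborel_quat, subst nn_integral_distr) (auto simp: sets_lborel)
  also have "\<dots> = (\<integral>\<^sup>+z. \<integral>\<^sup>+w. f (quat_of_pairs (z, w)) \<partial>lborel \<partial>lborel)"
    by (subst lborel.nn_integral_fst[symmetric]) auto
  finally show ?thesis .
qed

text \<open>A disc of squared radius \<open>a\<close> has area \<open>pi * a\<close>, which is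
  linear in \<open>a\<close>, so the squared norm has constant density \<open>pi\<close>. Half-lines
  suffice as generator; \<open>max 0 a\<close> in the proof covers negative \<open>a\<close>, where
  both measures give 0.\<close>

lemma lborel_norm_sq_R2:
  "distr (lborel :: (real \<times> real) measure) borel (\<lambda>z. (norm z)\<^sup>2)
    = density lborel (\<lambda>s. ennreal (pi * indicator {0..} s))" (is "?M = ?N")
proof (rule measure_eqI_generator_eq)
  let ?E = "range (\<lambda>a::real. {..a})"
  have M: "emeasure ?M {..a} = ennreal (pi * max 0 a)" for a
  proof -
    have "(\<lambda>z::real \<times> real. (norm z)\<^sup>2) -` {..a} = (if a < 0 then {} else cball 0 (sqrt a))"
      by (auto simp: real_le_rsqrt power2_le_iff_abs_le sqrt_ge_absD intro: order_trans[OF zero_le_power2] dest: real_le_rsqrt)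
        (smt (verit) zero_le_power2)
    then show ?thesis
      by (simp add: emeasure_distr emeasure_cball eval_unit_ball_vol)
  qed
  have N: "emeasure ?N {..a} = ennreal (pi * max 0 a)" for a
  proof -
    have "emeasure ?N {..a} = (\<integral>\<^sup>+s. ennreal pi * indicator {0..a} s \<partial>lborel)"
      by (subst emeasure_density) (auto intro!: nn_integral_cong split: split_indicator)
    then show ?thesis by (simp add: nn_integral_cmult ennreal_mult[symmetric] max_def)
  qed
  show "emeasure ?M X = emeasure ?N X" if "X \<in> ?E" for X
    using that M N by auto
  show "emeasure ?M ((\<lambda>n. {..real n}) i) \<noteq> \<infinity>" for i
    using M by simp
  show "Int_stable ?E" by (auto simp: Int_stable_def)
  show "sets ?M = sigma_sets UNIV ?E" "sets ?N = sigma_sets UNIV ?E"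
    by (simp_all add: borel_eq_atMost)
  show "(\<Union>i. {..real i}) = UNIV" by (auto intro: real_arch_simple)
qed auto

lemma nn_integral_norm_sq_R2:
  assumes [measurable]: "g \<in> borel_measurable (borel :: real measure)"
  shows "(\<integral>\<^sup>+z. g ((norm (z :: real \<times> real))\<^sup>2) \<partial>lborel) = ennreal pi * (\<integral>\<^sup>+s. g s * indicator {0..} s \<partial>lborel)"
proof -
  have "(\<integral>\<^sup>+z. g ((norm (z :: real \<times> real))\<^sup>2) \<partial>lborel) = (\<integral>\<^sup>+s. g s \<partial>(distr (lborel :: (real \<times> real) measure) borel (\<lambda>z. (norm z)\<^sup>2)))"
    by (subst nn_integral_distr) auto
  also have "\<dots> = (\<integral>\<^sup>+s. ennreal pi * (g s * indicator {0..} s) \<partial>lborel)"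
    unfolding lborel_norm_sq_R2
    by (subst nn_integral_density) (auto intro!: nn_integral_cong split: split_indicator)
  finally show ?thesis by (simp add: nn_integral_cmult)
qed

lemma nn_integral_lborel_scaleR:
  fixes f :: "'a::euclidean_space \<Rightarrow> ennreal"
  assumes [measurable]: "f \<in> borel_measurable borel" and c: "c \<noteq> 0"
  shows "(\<integral>\<^sup>+x. f x \<partial>lborel) = ennreal (\<bar>c\<bar> ^ DIM('a)) * (\<integral>\<^sup>+x. f (c *\<^sub>R x) \<partial>lborel)"
  by (subst lborel_affine[OF c, of 0])
     (simp add: nn_integral_density nn_integral_distr nn_integral_cmult)

lemma norm_quat_of_pairs: "norm (quat_of_pairs (z, w)) = sqrt ((norm z)\<^sup>2 + (norm w)\<^sup>2)"
proof -
  have "(norm (quat_of_pairs (z, w)))\<^sup>2 = (norm z)\<^sup>2 + (norm w)\<^sup>2"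
    by (cases z; cases w) (simp add: norm_quat_sq quat_of_pairs_def vector_4 norm_prod_def)
  then show ?thesis by (metis norm_ge_zero real_sqrt_unique)
qed

lemma emeasure_ball_quat: "emeasure lborel (ball 0 1 :: quat set) = ennreal (pi\<^sup>2 / 2)"
  by (simp add: emeasure_ball eval_unit_ball_vol)

text \<open>Substitute $q = |z|^2 + s$ for the squared norm, exchange the integrals, and scale $z$ by
  $\sqrt q$.\<close>
lemma nn_integral_ball_disc:
  fixes h :: "real \<times> real \<Rightarrow> ennreal"
  assumes [measurable]: "h \<in> borel_measurable borel"
  shows "(\<integral>\<^sup>+x. h (x$2 / norm x, x$3 / norm x) * indicator (ball 0 1) (x :: quat) \<partial>lborel)
     = ennreal (pi / 2) * (\<integral>\<^sup>+z. h z * indicator (cball 0 1) z \<partial>lborel)"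
proof -
  define I where "I = (\<integral>\<^sup>+z. h z * indicator (cball 0 1) z \<partial>lborel)"
  \<comment> \<open>This is the integrand at a quaternion of squared norm \<open>q\<close> whose
    first pair of coordinates is \<open>z\<close>; the indicator restricts to the unit ball.\<close>
  define H :: "real \<times> real \<Rightarrow> real \<Rightarrow> ennreal" where "H z q = h ((1 / sqrt q) *\<^sub>R z) * indicator {..<1} q" for z q
  have [measurable]: "case_prod H \<in> borel_measurable (borel \<Otimes>\<^sub>M borel)"
    unfolding H_def by measurable
  have [measurable]: "H z \<in> borel_measurable borel" for z
    unfolding H_def by measurable
  have "(\<lambda>x :: quat. (x$2 / norm x, x$3 / norm x)) \<in> borel_measurable borel"
    by (simp add: borel_prod[symmetric])
  from measurable_compose[OF this assms]
  have m: "(\<lambda>x :: quat. h (x$2 / norm x, x$3 / norm x) * indicator (ball 0 1) x) \<in> borel_measurable borel"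
    by (rule borel_measurable_times_ennreal) (rule borel_measurable_indicator, simp)
  have mG: "(\<lambda>(z, q). H z q * indicator {(norm z)\<^sup>2..} q) \<in> borel_measurable (borel \<Otimes>\<^sub>M borel)"
  proof -
    \<comment> \<open>The set depends on \<open>z\<close>; a fixed set and a varying argument make
      joint measurability visible.\<close>
    have "indicator {(norm z)\<^sup>2..} q = (indicator {0..} (q - (norm z)\<^sup>2) :: ennreal)" for z :: "real \<times> real" and q
      by (simp split: split_indicator)
    then show ?thesis by simp
  qed
  have *: "h (x$2 / norm x, x$3 / norm x) * indicator (ball 0 1) x = H z ((norm z)\<^sup>2 + (norm w)\<^sup>2)"
    if "x = quat_of_pairs (z, w)" for x z w
  proof -
    have "indicator (ball 0 1) x = (indicator {..<1} ((norm z)\<^sup>2 + (norm w)\<^sup>2) :: ennreal)"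
      by (simp add: that norm_quat_of_pairs split: split_indicator)
    moreover have "(x$2 / norm x, x$3 / norm x) = (1 / sqrt ((norm z)\<^sup>2 + (norm w)\<^sup>2)) *\<^sub>R z"
      by (cases z) (simp add: that norm_quat_of_pairs, simp add: quat_of_pairs_def)
    ultimately show ?thesis by (simp add: H_def)
  qed
  have inner: "(\<integral>\<^sup>+w. H z ((norm z)\<^sup>2 + (norm (w :: real \<times> real))\<^sup>2) \<partial>lborel)
      = ennreal pi * (\<integral>\<^sup>+q. H z q * indicator {(norm z)\<^sup>2..} q \<partial>lborel)" for z
  proof -
    have "(\<integral>\<^sup>+q. H z q * indicator {(norm z)\<^sup>2..} q \<partial>lborel)
      = (\<integral>\<^sup>+s. H z ((norm z)\<^sup>2 + s) * indicator {0..} s \<partial>lborel)"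
      by (subst nn_integral_real_affine[where c=1 and t="(norm z)\<^sup>2"])
        (auto intro!: nn_integral_cong split: split_indicator)
    then show ?thesis
      using nn_integral_norm_sq_R2[of "\<lambda>s. H z ((norm z)\<^sup>2 + s)"] by simp
  qed
  \<comment> \<open>Scaling the plane by \<open>sqrt q\<close> multiplies area by \<open>q\<close>.
    Two values are left out as a null set: at \<open>q = 0\<close> the integrand may be nonzero at
    the origin, and at \<open>q = 1\<close> the open ball on the left meets the closed interval on
    the right.\<close>
  have slice: "(\<integral>\<^sup>+z. H z q * indicator {(norm z)\<^sup>2..} q \<partial>lborel) = ennreal (q * indicator {0..1} q) * I"
    if q: "q \<noteq> 0" "q \<noteq> 1" for q
  proof (cases "0 < q \<and> q < 1")
    case False
    then have "H z q * indicator {(norm z)\<^sup>2..} q = 0" for z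
      using q by (auto simp: H_def split: split_indicator) (smt (verit) zero_le_power2)
    moreover have "indicator {0..1} q = (0 :: real)" using False q by auto
    ultimately show ?thesis by (simp del: mult_eq_0_iff)
  next
    case True
    have "H (sqrt q *\<^sub>R z) q * indicator {(norm (sqrt q *\<^sub>R z))\<^sup>2..} q = h z * indicator (cball 0 1) z" for z
      using True by (auto simp: H_def power_mult_distrib abs_square_le_1 split: split_indicator)
    moreover have "(\<lambda>z. H z q * indicator {(norm z)\<^sup>2..} q) \<in> borel_measurable borel"
      using measurable_compose[OF _ mG, of "\<lambda>z. (z, q)" borel] by simp
    ultimately show ?thesis
      using True by (subst nn_integral_lborel_scaleR[where c="sqrt q"]) (simp_all add: I_def)
  qed
  have "(\<integral>\<^sup>+x. h (x$2 / norm x, x$3 / norm x) * indicator (ball 0 1) (x :: quat) \<partial>lborel)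
      = (\<integral>\<^sup>+z. ennreal pi * (\<integral>\<^sup>+q. H z q * indicator {(norm z)\<^sup>2..} q \<partial>lborel) \<partial>lborel)"
    by (subst nn_integral_quat[OF m]) (simp add: * inner)
  also have "\<dots> = ennreal pi * (\<integral>\<^sup>+q. \<integral>\<^sup>+z. H z q * indicator {(norm z)\<^sup>2..} q \<partial>lborel \<partial>lborel)"
  proof -
    have mG': "(\<lambda>(z, q). H z q * indicator {(norm z)\<^sup>2..} q) \<in> borel_measurable (lborel \<Otimes>\<^sub>M lborel)"
      using mG by simp
    have "(\<integral>\<^sup>+z. ennreal pi * (\<integral>\<^sup>+q. H z q * indicator {(norm z)\<^sup>2..} q \<partial>lborel) \<partial>lborel)
      = ennreal pi * (\<integral>\<^sup>+z. \<integral>\<^sup>+q. H z q * indicator {(norm z)\<^sup>2..} q \<partial>lborel \<partial>lborel)"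
      by (rule nn_integral_cmult) (rule lborel.borel_measurable_nn_integral[OF mG'])
    then show ?thesis by (simp add: lborel_pair.Fubini'[OF mG'])
  qed
  also have "(\<integral>\<^sup>+q. \<integral>\<^sup>+z. H z q * indicator {(norm z)\<^sup>2..} q \<partial>lborel \<partial>lborel) = (\<integral>\<^sup>+q. ennreal (q * indicator {0..1} q) * I \<partial>lborel)"
    using AE_lborel_singleton[of "0 :: real"] AE_lborel_singleton[of "1 :: real"]
    by (intro nn_integral_cong_AE, eventually_elim) (rule slice)
  also have "\<dots> = (\<integral>\<^sup>+q. ennreal q * indicator {0..1} q \<partial>lborel) * I"
    by (subst nn_integral_multc[symmetric]) (auto intro!: nn_integral_cong split: split_indicator)
  also have "(\<integral>\<^sup>+q. ennreal q * indicator {0..1} q \<partial>lborel) = ennreal (1\<^sup>2 / 2 - 0\<^sup>2 / 2)"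
    by (rule nn_integral_FTC_Icc) (auto intro!: derivative_eq_intros)
  finally show ?thesis
    using ennreal_mult[of pi "1 / 2"] by (simp add: I_def[symmetric] mult.assoc del: ennreal_half)
qed

section \<open>The sphere measure and its projection to a disc\<close>

lemma sets_sphere_haar [simp, measurable_cong]: "sets sphere_haar = sets borel"
  by (simp add: sphere_haar_def)

lemma space_sphere_haar [simp]: "space sphere_haar = UNIV"
  by (simp add: sphere_haar_def)

lemma prob_space_sphere_haar: "prob_space sphere_haar"
  unfolding sphere_haar_def
  by (intro prob_space.prob_space_distr prob_space_uniform_measure) (auto simp: emeasure_ball_quat)

text \<open>The factor \<open>pi / 2\<close> from \<open>nn_integral_ball_disc\<close>, divided by
  the volume \<open>pi^2 / 2\<close> of the unit ball, is \<open>1 / pi\<close>, the density of the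
  uniform law on the unit disc.\<close>

lemma sphere_haar_disc:
  "distr sphere_haar borel (\<lambda>x. (x$2, x$3)) = uniform_measure lborel (cball 0 1)"
proof (rule measure_eqI)
  fix X assume "X \<in> sets (distr sphere_haar borel (\<lambda>x. (x$2, x$3)))"
  then have [measurable]: "X \<in> sets borel" by simp
  have "distr sphere_haar borel (\<lambda>x. (x$2, x$3))
      = distr (uniform_measure lborel (ball 0 1 :: quat set)) borel (\<lambda>x. (x$2 / norm x, x$3 / norm x))"
    by (simp add: sphere_haar_def distr_distr o_def divide_inverse mult.commute)
  then have "emeasure (distr sphere_haar borel (\<lambda>x. (x$2, x$3))) X
      = (\<integral>\<^sup>+z. indicator X z \<partial>distr (uniform_measure lborel (ball 0 1 :: quat set)) borel (\<lambda>x. (x$2 / norm x, x$3 / norm x)))"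
    by simp
  also have "\<dots> = (\<integral>\<^sup>+x. indicator X (x$2 / norm x, x$3 / norm x) \<partial>uniform_measure lborel (ball 0 1 :: quat set))"
    by (subst nn_integral_distr) auto
  also have "\<dots> = ennreal (pi / 2) * (\<integral>\<^sup>+z. indicator X z * indicator (cball 0 1) z \<partial>lborel) / ennreal (pi\<^sup>2 / 2)"
    by (subst nn_integral_uniform_measure) (simp_all add: nn_integral_ball_disc emeasure_ball_quat)
  also have "(\<integral>\<^sup>+z. indicator X z * indicator (cball 0 1) z \<partial>lborel) = emeasure lborel (cball 0 1 \<inter> X)"
    by (simp add: indicator_inter_arith[symmetric] Int_commute)
  also have "ennreal (pi / 2) * emeasure lborel (cball 0 1 \<inter> X) / ennreal (pi\<^sup>2 / 2) = emeasure lborel (cball 0 1 \<inter> X) / ennreal pi"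
  proof -
    \<comment> \<open>Finiteness lets the cancellation of \<open>pi\<close> take place among real
      numbers.\<close>
    have "emeasure lborel (cball 0 1 \<inter> X) \<noteq> \<infinity>"
      using emeasure_lborel_cball_finite[of "0 :: real \<times> real" 1] emeasure_mono[of "cball 0 1 \<inter> X" "cball 0 1" lborel]
      by (auto simp: top_unique)
    then obtain m where "m \<ge> 0" "emeasure lborel (cball 0 1 \<inter> X) = ennreal m"
      by (cases "emeasure lborel (cball 0 1 \<inter> X)") auto
    then show ?thesis
      by (simp add: ennreal_mult[symmetric] divide_ennreal power2_eq_square)
  qed
  also have "\<dots> = emeasure (uniform_measure lborel (cball 0 1)) X"
    by (simp add: emeasure_cball eval_unit_ball_vol)
  finally show "emeasure (distr sphere_haar borel (\<lambda>x. (x$2, x$3))) X = emeasure (uniform_measure lborel (cball 0 1)) X" .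
qed simp

section \<open>Invariance under orthogonal maps, and a supply of such maps\<close>

lemma measurable_orthogonal_transformation:
  fixes R :: "'a::euclidean_space \<Rightarrow> 'a"
  assumes "orthogonal_transformation R"
  shows "R \<in> borel_measurable borel"
  using assms by (intro borel_measurable_continuous_onI linear_continuous_on)
    (auto simp: orthogonal_transformation_linear linear_conv_bounded_linear[symmetric])

text \<open>It suffices to test boxes. The preimage of a box is its image under the inverse map,
  which is again orthogonal and so preserves volume.\<close>

lemma lborel_distr_orthogonal:
  fixes R :: "(real, 'n :: {finite, wellorder}) vec \<Rightarrow> (real, 'n) vec"
  assumes R: "orthogonal_transformation R"
  shows "distr lborel borel R = lborel"
proof (rule lborel_eqI[symmetric])
  note [measurable] = measurable_orthogonal_transformation[OF R]
  fix l u :: "(real, 'n) vec" assume le: "\<And>b. b \<in> Basis \<Longrightarrow> l \<bullet> b \<le> u \<bullet> b"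
  have inv: "R -` S = inv R ` S" for S
    using R by (simp add: bij_vimage_eq_inv_image orthogonal_transformation_bij)
  have m: "R -` box l u \<in> sets borel" using measurable_sets[of R borel borel "box l u"] by simp
  have "R -` box l u \<in> lmeasurable" "measure lebesgue (R -` box l u) = measure lebesgue (box l u)"
    unfolding inv
    using measurable_orthogonal_image[OF orthogonal_transformation_inv[OF R] lmeasurable_box]
      measure_orthogonal_image[OF orthogonal_transformation_inv[OF R] lmeasurable_box] .
  then have "emeasure lebesgue (R -` box l u) = emeasure lebesgue (box l u)"
    by (simp add: emeasure_eq_measure2 fmeasurableD2 lmeasurable_box)
  then have "emeasure lborel (R -` box l u) = emeasure lborel (box l u)"
    using m by simp
  then show "emeasure (distr lborel borel R) (box l u) = (\<Prod>b\<in>Basis. (u - l) \<bullet> b)"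
    using le by (simp add: emeasure_distr)
qed simp

text \<open>An orthogonal map preserves Lebesgue measure and the unit ball, and it commutes with
  radial projection.\<close>

lemma sphere_haar_distr_orthogonal:
  assumes R: "orthogonal_transformation R"
  shows "distr sphere_haar borel R = sphere_haar"
proof -
  let ?p = "\<lambda>x :: quat. x /\<^sub>R norm x" and ?U = "uniform_measure lborel (ball 0 1 :: quat set)"
  note [measurable] = measurable_orthogonal_transformation[OF R]
  have n: "norm (R x) = norm x" for x
    using R by (rule orthogonal_transformation_norm)
  have comm: "R (?p x) = ?p (R x)" for x
    using R n by (simp add: linear_cmul orthogonal_transformation_linear)
  have U: "distr ?U borel R = ?U"
  proof (rule measure_eqI)
    fix X assume "X \<in> sets (distr ?U borel R)"
    then have [measurable]: "X \<in> sets borel" by simp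
    have "ball 0 1 \<inter> R -` X = R -` (ball 0 1 \<inter> X)"
      by (auto simp: n)
    then have "emeasure lborel (ball 0 1 \<inter> R -` X) = emeasure (distr lborel borel R) (ball 0 1 \<inter> X)"
      by (simp add: emeasure_distr)
    moreover have "R -` X \<in> sets borel" using measurable_sets[of R borel borel X] by simp
    ultimately show "emeasure (distr ?U borel R) X = emeasure ?U X"
      by (simp add: emeasure_distr lborel_distr_orthogonal[OF R])
  qed simp
  have "distr sphere_haar borel R = distr (distr ?U borel R) borel ?p"
    unfolding sphere_haar_def by (simp add: distr_distr o_def comm)
  then show ?thesis by (simp add: U sphere_haar_def)
qed

text \<open>The map is the reflection in the hyperplane orthogonal to \<open>p - q\<close>; equal
  norms make it send \<open>p\<close> to \<open>q\<close>. The last clause, that it fixes this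
  hyperplane, later keeps the real axis in place.\<close>

lemma ex_householder:
  fixes p q :: "'a :: euclidean_space"
  assumes "norm p = norm q"
  shows "\<exists>R. orthogonal_transformation R \<and> R p = q \<and> (\<forall>x. x \<bullet> p = x \<bullet> q \<longrightarrow> R x = x)"
proof (cases "p = q")
  case True
  then show ?thesis by (intro exI[of _ id]) (auto simp: id_def orthogonal_transformation_id[unfolded id_def])
next
  case False
  define w where "w = p - q"
  define R where "R x = x - (2 * (x \<bullet> w) / (w \<bullet> w)) *\<^sub>R w" for x
  have w: "w \<bullet> w \<noteq> 0" using False by (simp add: w_def)
  have "p \<bullet> p = q \<bullet> q" using assms by (simp add: norm_eq)
  then have pw: "2 * (p \<bullet> w) = w \<bullet> w"
    by (simp add: w_def inner_diff inner_commute)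
  have "orthogonal_transformation R"
    unfolding orthogonal_transformation_def
  proof
    show "linear R"
      by (rule linearI) (simp_all add: R_def inner_add inner_simps add_divide_distrib algebra_simps)
    show "\<forall>x y. R x \<bullet> R y = x \<bullet> y"
      using w by (simp add: R_def inner_simps field_simps inner_commute)
  qed
  moreover have "R p = q" using pw w by (simp add: R_def) (simp add: w_def)
  moreover have "x \<bullet> p = x \<bullet> q \<longrightarrow> R x = x" for x by (simp add: R_def w_def inner_diff)
  ultimately show ?thesis by blast
qed

section \<open>One coordinate of a uniform point of the disc\<close>

lemma nn_integral_R2:
  fixes f :: "real \<times> real \<Rightarrow> ennreal"
  assumes "f \<in> borel_measurable borel"
  shows "(\<integral>\<^sup>+z. f z \<partial>lborel) = (\<integral>\<^sup>+a. \<integral>\<^sup>+b. f (a, b) \<partial>lborel \<partial>lborel)"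
proof -
  have "f \<in> borel_measurable (lborel \<Otimes>\<^sub>M lborel)" using assms by (simp add: lborel_prod)
  from lborel.nn_integral_fst[OF this] show ?thesis by (simp add: lborel_prod)
qed

text \<open>The vertical chord of the disc at abscissa \<open>a\<close> has length
  \<open>2 * sqrt (1 - a^2)\<close>; division by the area \<open>pi\<close> gives the semicircle
  law.\<close>

lemma uniform_disc_fst:
  "distr (uniform_measure lborel (cball (0 :: real \<times> real) 1)) borel fst
    = density lborel (\<lambda>a. ennreal (2 / pi * sqrt (1 - a\<^sup>2) * indicator {-1..1} a))"
proof (rule measure_eqI)
  let ?M = "uniform_measure lborel (cball 0 1) :: (real \<times> real) measure"
  fix X assume "X \<in> sets (distr ?M borel fst)"
  then have [measurable]: "X \<in> sets borel" by simp
  have [measurable]: "(fst :: real \<times> real \<Rightarrow> real) \<in> borel_measurable borel"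
    by (intro borel_measurable_continuous_onI continuous_intros)
  have slice: "(\<integral>\<^sup>+b. indicator (cball 0 1) (a, b :: real) \<partial>lborel) = ennreal (2 * sqrt (1 - a\<^sup>2) * indicator {-1..1} a)" for a :: real
  proof (cases "\<bar>a\<bar> \<le> 1")
    case True
    then have a: "a\<^sup>2 \<le> 1" by (simp add: abs_square_le_1)
    have "(indicator (cball 0 1) (a, b) :: ennreal) = indicator {- sqrt (1 - a\<^sup>2)..sqrt (1 - a\<^sup>2)} b" for b
    proof -
      have "norm (a, b) \<le> 1 \<longleftrightarrow> b\<^sup>2 \<le> 1 - a\<^sup>2" by (simp add: norm_Pair algebra_simps)
      also have "\<dots> \<longleftrightarrow> \<bar>b\<bar> \<le> sqrt (1 - a\<^sup>2)"
        using a by (metis abs_ge_zero diff_ge_0_iff_ge power2_abs real_le_rsqrt real_sqrt_abs real_sqrt_le_iff sqrt_le_D)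
      finally show ?thesis by (auto split: split_indicator)
    qed
    then have "(\<integral>\<^sup>+b. indicator (cball 0 1) (a, b :: real) \<partial>lborel) = emeasure lborel {- sqrt (1 - a\<^sup>2)..sqrt (1 - a\<^sup>2)}"
      by (simp only: nn_integral_indicator sets_lborel borel_closed closed_atLeastAtMost)
    then show ?thesis using True a by (simp add: abs_le_iff)
  next
    case False
    then have "\<not> norm (a, b) \<le> 1" for b :: real using norm_fst_le[of a b] by auto
    then have "indicator (cball 0 1) (a, b) = (0 :: ennreal)" for b :: real by simp
    moreover have "indicator {-1..1} a = (0 :: real)" using False by (auto simp: indicator_def)
    ultimately show ?thesis by simp
  qed
  have slice': "(\<integral>\<^sup>+b. indicator X a * indicator (cball 0 1) (a, b :: real) \<partial>lborel)
      = indicator X a * ennreal (2 * sqrt (1 - a\<^sup>2) * indicator {-1..1} a)" for a :: real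
  proof -
    have "Pair a \<in> borel \<rightarrow>\<^sub>M (borel :: (real \<times> real) measure)"
      by (intro borel_measurable_continuous_onI continuous_intros)
    then have "(\<lambda>b. indicator (cball 0 1) (a, b :: real) :: ennreal) \<in> borel_measurable borel"
      by (rule measurable_compose) (rule borel_measurable_indicator, simp)
    then show ?thesis
      by (subst nn_integral_cmult) (simp_all add: slice)
  qed
  have "emeasure (distr ?M borel fst) X = (\<integral>\<^sup>+s. indicator X s \<partial>distr ?M borel fst)" by simp
  also have "\<dots> = (\<integral>\<^sup>+z. indicator X (fst z) \<partial>?M)"
    by (subst nn_integral_distr) auto
  also have "\<dots> = (\<integral>\<^sup>+z. indicator X (fst z) * indicator (cball 0 1 :: (real \<times> real) set) z \<partial>lborel) / ennreal pi"
    by (subst nn_integral_uniform_measure) (auto simp: emeasure_cball eval_unit_ball_vol)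
  also have "(\<integral>\<^sup>+z. indicator X (fst z) * indicator (cball 0 1 :: (real \<times> real) set) z \<partial>lborel)
      = (\<integral>\<^sup>+a. \<integral>\<^sup>+b. indicator X a * indicator (cball 0 1) (a, b :: real) \<partial>lborel \<partial>lborel)"
    by (subst nn_integral_R2, intro borel_measurable_times_ennreal borel_measurable_indicator
      measurable_compose[of fst borel borel "indicator X"]) simp_all
  also have "\<dots> = (\<integral>\<^sup>+a. indicator X a * ennreal (2 * sqrt (1 - a\<^sup>2) * indicator {-1..1} a) \<partial>lborel)"
    by (intro nn_integral_cong) (rule slice')
  also have "\<dots> / ennreal pi = (\<integral>\<^sup>+a. ennreal (2 / pi * sqrt (1 - a\<^sup>2) * indicator {-1..1} a) * indicator X a \<partial>lborel)"
    by (subst nn_integral_divide[symmetric])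
      (auto intro!: nn_integral_cong simp: divide_ennreal abs_square_le_1 split: split_indicator)
  finally show "emeasure (distr ?M borel fst) X = emeasure (density lborel (\<lambda>a. ennreal (2 / pi * sqrt (1 - a\<^sup>2) * indicator {-1..1} a))) X"
    by (simp add: emeasure_density)
qed simp

subsection \<open>The laws of the commutator and of the imaginary part\<close>

definition commutator_sq :: "quat \<Rightarrow> quat \<Rightarrow> real" where
  "commutator_sq x y = (norm (qmult x y - qmult y x))\<^sup>2"

definition imag_sq :: "quat \<Rightarrow> real" where
  "imag_sq x = (x$2)\<^sup>2 + (x$3)\<^sup>2 + (x$4)\<^sup>2"

text \<open>The commutator is twice the cross product of the imaginary parts, and Lagrange's
  identity expresses the squared length of a cross product by inner products.\<close>

lemma commutator_sq_eq:
  "commutator_sq x y = 4 * (imag_sq x * imag_sq y - (x$2 * y$2 + x$3 * y$3 + x$4 * y$4)\<^sup>2)"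
  unfolding commutator_sq_def norm_quat_sq imag_sq_def
  by (simp add: qmult_def) algebra

text \<open>A commutator has real part 0, hence is orthogonal to 1, and Pythagoras applies.\<close>

lemma norm_commutator_plus_one_sq:
  "(norm (qmult x y - qmult y x + qone))\<^sup>2 = 1 + commutator_sq x y"
  unfolding commutator_sq_def norm_quat_sq
  by (simp add: qmult_def qone_def)

lemma measurable_commutator_sq [measurable]:
  "(\<lambda>p. commutator_sq (fst p) (snd p)) \<in> borel_measurable (borel \<Otimes>\<^sub>M borel)"
  unfolding commutator_sq_eq imag_sq_def by measurable

lemma measurable_commutator_sq_right [measurable]: "commutator_sq x \<in> borel_measurable borel"
  unfolding commutator_sq_eq[abs_def] imag_sq_def by measurable

lemma measurable_imag_sq [measurable]: "imag_sq \<in> borel_measurable borel"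
  unfolding imag_sq_def[abs_def] by measurable

text \<open>Once the imaginary part of \<open>x\<close> lies on axis 4, the subtracted inner product
  in \<open>commutator_sq_eq\<close> removes exactly coordinate 4 of the rotated \<open>y\<close>.
  Coordinates 2 and 3 remain, the pair treated in \<open>sphere_haar_disc\<close>.\<close>

lemma commutator_sq_rotated:
  "\<exists>R :: quat \<Rightarrow> quat. orthogonal_transformation R \<and>
    (\<forall>y. commutator_sq x y = 4 * imag_sq x * (((R y)$2)\<^sup>2 + ((R y)$3)\<^sup>2))"
proof -
  define p :: quat where "p = vector [0, x$2, x$3, x$4]"
  define q :: quat where "q = axis 4 (norm p)"
  have p: "(norm p)\<^sup>2 = imag_sq x" by (simp add: norm_quat_sq p_def imag_sq_def)
  have "norm q = norm p" by (simp add: q_def norm_vec_def L2_set_def axis_def sum_4)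
  then obtain R where R: "orthogonal_transformation R" "R p = q" "\<forall>y. y \<bullet> p = y \<bullet> q \<longrightarrow> R y = y"
    using ex_householder[of p q] by metis
  \<comment> \<open>Both \<open>p\<close> and \<open>q\<close> have real part 0, so the real axis
    lies in the fixed hyperplane.\<close>
  have e1: "R (axis 1 1) = axis 1 1"
    by (intro R(3)[rule_format]) (simp add: inner_commute[of "axis 1 1"] inner_axis, simp add: p_def q_def axis_def)
  have "commutator_sq x y = 4 * imag_sq x * (((R y)$2)\<^sup>2 + ((R y)$3)\<^sup>2)" for y
  proof -
    have "R y \<bullet> R (axis 1 1) = y \<bullet> axis 1 1" "R y \<bullet> R p = y \<bullet> p" "norm (R y) = norm y"
      using R(1) by (auto simp: orthogonal_transformation_def norm_eq)
    then have 1: "(R y)$1 = y$1" and 2: "(R y)$4 * norm p = x$2 * y$2 + x$3 * y$3 + x$4 * y$4"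
      and 3: "(norm (R y))\<^sup>2 = (norm y)\<^sup>2"
      by (simp_all add: e1 R(2) q_def inner_axis, simp add: p_def inner_vec_def sum_4 mult.commute)
    have "imag_sq y = ((R y)$2)\<^sup>2 + ((R y)$3)\<^sup>2 + ((R y)$4)\<^sup>2"
      using 3 1 by (simp add: norm_quat_sq imag_sq_def)
    moreover have "(x$2 * y$2 + x$3 * y$3 + x$4 * y$4)\<^sup>2 = ((R y)$4)\<^sup>2 * imag_sq x"
      by (simp add: 2[symmetric] power_mult_distrib p)
    ultimately show ?thesis
      by (simp add: commutator_sq_eq algebra_simps)
  qed
  with R(1) show ?thesis by blast
qed

lemma uniform_disc_norm_sq:
  "distr (uniform_measure lborel (cball 0 1)) borel (\<lambda>z :: real \<times> real. (norm z)\<^sup>2)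
    = uniform_measure lborel {0..1::real}"
proof (rule measure_eqI)
  fix X assume "X \<in> sets (distr (uniform_measure lborel (cball 0 1)) borel (\<lambda>z :: real \<times> real. (norm z)\<^sup>2))"
  then have [measurable]: "X \<in> sets borel" by simp
  let ?M = "uniform_measure lborel (cball 0 1) :: (real \<times> real) measure"
  have "emeasure (distr ?M borel (\<lambda>z. (norm z)\<^sup>2)) X
    = (\<integral>\<^sup>+s. indicator X s \<partial>distr ?M borel (\<lambda>z. (norm z)\<^sup>2))" by simp
  also have "\<dots> = (\<integral>\<^sup>+z. indicator X ((norm z)\<^sup>2) \<partial>?M)"
    by (subst nn_integral_distr) auto
  also have "\<dots> = (\<integral>\<^sup>+z. indicator X ((norm z)\<^sup>2) * indicator (cball 0 1 :: (real \<times> real) set) z \<partial>lborel) / ennreal pi"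
    by (subst nn_integral_uniform_measure) (simp_all add: emeasure_cball eval_unit_ball_vol)
  also have "(\<integral>\<^sup>+z. indicator X ((norm z)\<^sup>2) * indicator (cball 0 1 :: (real \<times> real) set) z \<partial>lborel)
      = (\<integral>\<^sup>+z. indicator (X \<inter> {..1}) ((norm (z :: real \<times> real))\<^sup>2) \<partial>lborel)"
    by (intro nn_integral_cong) (auto simp: abs_square_le_1 split: split_indicator)
  also have "\<dots> = ennreal pi * (\<integral>\<^sup>+s. indicator (X \<inter> {..1}) s * indicator {0..} s \<partial>lborel)"
    by (rule nn_integral_norm_sq_R2) simp
  also have "(\<integral>\<^sup>+s. indicator (X \<inter> {..1}) s * indicator {0..} s \<partial>lborel)
      = (\<integral>\<^sup>+s. indicator ({0..1} \<inter> X) s \<partial>lborel)"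
    by (intro nn_integral_cong) (auto split: split_indicator)
  also have "ennreal pi * \<dots> / ennreal pi = emeasure lborel ({0..1} \<inter> X)"
    by (subst mult.commute) (simp add: ennreal_mult_divide_eq)
  finally show "emeasure (distr ?M borel (\<lambda>z. (norm z)\<^sup>2)) X = emeasure (uniform_measure lborel {0..1}) X"
    by (simp add: divide_ennreal_def)
qed simp

lemma commutator_sq_law:
  "distr sphere_haar borel (commutator_sq x)
    = distr (uniform_measure lborel {0..1}) borel (\<lambda>t. 4 * imag_sq x * t)"
proof -
  obtain R :: "quat \<Rightarrow> quat" where R: "orthogonal_transformation R"
    and eq: "\<And>y. commutator_sq x y = 4 * imag_sq x * (((R y)$2)\<^sup>2 + ((R y)$3)\<^sup>2)"
    using commutator_sq_rotated by blast
  note [measurable] = measurable_orthogonal_transformation[OF R]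
  have "distr sphere_haar borel (commutator_sq x)
    = distr (distr sphere_haar borel R) borel (\<lambda>y. 4 * imag_sq x * ((y$2)\<^sup>2 + (y$3)\<^sup>2))"
    by (simp add: distr_distr o_def eq[abs_def])
  \<comment> \<open>The map \<open>R\<close> depends on \<open>x\<close>, which is fixed here, so
    invariance of the law of \<open>y\<close> absorbs it.\<close>
  also have "\<dots> = distr sphere_haar borel (\<lambda>y. 4 * imag_sq x * ((y$2)\<^sup>2 + (y$3)\<^sup>2))"
    by (simp add: sphere_haar_distr_orthogonal[OF R])
  also have "\<dots> = distr (distr (distr sphere_haar borel (\<lambda>y. (y$2, y$3))) borel (\<lambda>z. (norm z)\<^sup>2)) borel (\<lambda>t. 4 * imag_sq x * t)"
    by (simp add: distr_distr o_def norm_Pair)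
  finally show ?thesis by (simp add: sphere_haar_disc uniform_disc_norm_sq)
qed

lemma AE_sphere_haar_norm: "AE x in sphere_haar. norm x = 1"
proof -
  \<comment> \<open>At the origin the radial projection takes the default value 0, which has norm
    0.\<close>
  have "AE x in uniform_measure lborel (ball 0 1 :: quat set). x \<noteq> 0"
    by (rule AE_uniform_measureI) (use AE_lborel_singleton[of "0::quat"] in auto)
  then have "AE x in uniform_measure lborel (ball 0 1 :: quat set). norm (x /\<^sub>R norm x) = 1"
    by eventually_elim simp
  then show ?thesis unfolding sphere_haar_def by (subst AE_distr_iff) auto
qed

text \<open>On the sphere \<open>imag_sq x\<close> is \<open>1 - (x$1)^2\<close>. An orthogonal map
  taking axis 1 to axis 2 gives the real part the law of coordinate 2, the semicircle law, and the
  substitution \<open>a = - cos t\<close> turns it into the density in \<open>t\<close>.\<close>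

lemma imag_sq_law:
  "distr sphere_haar borel imag_sq
    = distr (density lborel (\<lambda>t. ennreal (2 / pi * (sin t)\<^sup>2 * indicator {0..pi} t))) borel (\<lambda>t. (sin t)\<^sup>2)"
    (is "_ = distr ?D _ _")
proof -
  obtain R :: "quat \<Rightarrow> quat" where R: "orthogonal_transformation R" and R2: "R (axis 1 1) = axis 2 1"
    using ex_householder[of "axis 1 1 :: quat" "axis 2 1"] by auto
  note [measurable] = measurable_orthogonal_transformation[OF R]
  have [measurable]: "(fst :: real \<times> real \<Rightarrow> real) \<in> borel_measurable borel"
    by (intro borel_measurable_continuous_onI continuous_intros)
  have Rx: "(R x)$2 = x$1" for x
  proof -
    have "R x \<bullet> R (axis 1 1) = x \<bullet> axis 1 1" using R by (simp add: orthogonal_transformation_def)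
    then show ?thesis by (simp add: R2 inner_axis)
  qed
  have "distr sphere_haar borel (\<lambda>x. x$1) = distr (distr sphere_haar borel R) borel (\<lambda>x. x$2)"
    by (simp add: distr_distr o_def Rx)
  also have "\<dots> = distr (distr sphere_haar borel (\<lambda>x. (x$2, x$3))) borel fst"
    by (simp add: sphere_haar_distr_orthogonal[OF R] distr_distr o_def)
  finally have x1: "distr sphere_haar borel (\<lambda>x. x$1) = density lborel (\<lambda>a. ennreal (2 / pi * sqrt (1 - a\<^sup>2) * indicator {-1..1} a))"
    by (simp add: sphere_haar_disc uniform_disc_fst)
  have "distr sphere_haar borel imag_sq = distr sphere_haar borel (\<lambda>x. 1 - (x$1)\<^sup>2)"
    by (rule distr_cong_AE) (use AE_sphere_haar_norm in \<open>auto elim!: eventually_mono simp: imag_sq_def norm_eq_1 power2_norm_eq_inner[symmetric] norm_quat_sq\<close>)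
  also have "\<dots> = distr (distr sphere_haar borel (\<lambda>x. x$1)) borel (\<lambda>a. 1 - a\<^sup>2)"
    by (simp add: distr_distr o_def)
  also have "\<dots> = distr ?D borel (\<lambda>t. (sin t)\<^sup>2)"
  proof (rule measure_eqI)
    fix X assume "X \<in> sets (distr (distr sphere_haar borel (\<lambda>x. x$1)) borel (\<lambda>a. 1 - a\<^sup>2))"
    then have [measurable]: "X \<in> sets borel" by simp
    have "emeasure (distr (distr sphere_haar borel (\<lambda>x. x$1)) borel (\<lambda>a. 1 - a\<^sup>2)) X
        = (\<integral>\<^sup>+s. indicator X s \<partial>distr (distr sphere_haar borel (\<lambda>x. x$1)) borel (\<lambda>a. 1 - a\<^sup>2))" by simp
    \<comment> \<open>The bounds -1 and 1 are written as values of \<open>- cos\<close>, which has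
      the nonnegative derivative \<open>sin\<close> on \<open>[0, pi]\<close>.\<close>
    also have "\<dots> = (\<integral>\<^sup>+a. ennreal (2 / pi * sqrt (1 - a\<^sup>2) * indicator X (1 - a\<^sup>2) * indicator {- cos 0..- cos pi} a) \<partial>lborel)"
      unfolding x1 by (subst nn_integral_distr, simp, simp, subst nn_integral_density)
        (auto intro!: nn_integral_cong split: split_indicator)
    also have "\<dots> = (\<integral>\<^sup>+t. ennreal (2 / pi * sqrt (1 - (- cos t)\<^sup>2) * indicator X (1 - (- cos t)\<^sup>2) * sin t * indicator {0..pi} t) \<partial>lborel)"
      by (rule nn_integral_substitution[where g="\<lambda>t. - cos t" and g'=sin])
        (auto intro!: derivative_eq_intros continuous_intros simp: sin_ge_zero set_borel_measurable_def)
    also have "\<dots> = (\<integral>\<^sup>+t. ennreal (2 / pi * (sin t)\<^sup>2 * indicator {0..pi} t) * indicator X ((sin t)\<^sup>2) \<partial>lborel)"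
    proof (intro nn_integral_cong)
      fix t :: real
      have "1 - (cos t)\<^sup>2 = (sin t)\<^sup>2" by (simp add: cos_squared_eq)
      then show "ennreal (2 / pi * sqrt (1 - (- cos t)\<^sup>2) * indicator X (1 - (- cos t)\<^sup>2) * sin t * indicator {0..pi} t)
          = ennreal (2 / pi * (sin t)\<^sup>2 * indicator {0..pi} t) * indicator X ((sin t)\<^sup>2)"
        using sin_ge_zero[of t]
        by (auto simp: ennreal_mult[symmetric] power2_eq_square split: split_indicator)
    qed
    also have "\<dots> = (\<integral>\<^sup>+s. indicator X s \<partial>distr ?D borel (\<lambda>t. (sin t)\<^sup>2))"
      by (subst nn_integral_distr, simp, simp, subst nn_integral_density) auto
    finally show "emeasure (distr (distr sphere_haar borel (\<lambda>x. x$1)) borel (\<lambda>a. 1 - a\<^sup>2)) X = emeasure (distr ?D borel (\<lambda>t. (sin t)\<^sup>2)) X"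
      by simp
  qed simp
  finally show ?thesis .
qed

subsection \<open>Logarithmic integrals\<close>

text \<open>For \<open>z = a * cis t\<close> the argument of \<open>ln\<close> is the squared
  modulus of \<open>1 - z\<close>, so the logarithm is twice the real part of
  \<open>Ln (1 - z)\<close>, given by its power series. The term at \<open>n = 0\<close> vanishes
  because division by 0 yields 0.\<close>

lemma ln_one_minus_cos_sums:
  fixes a t :: real
  assumes "\<bar>a\<bar> < 1"
  shows "(\<lambda>n. - 2 * a ^ n / real n * cos (real n * t)) sums ln (1 - 2 * a * cos t + a\<^sup>2)"
proof -
  define z where "z = complex_of_real a * cis t"
  have z: "cmod z < 1" using assms by (simp add: z_def norm_mult)
  have "1 - z \<noteq> 0" using z by auto
  have "(\<lambda>n. - (z ^ n) / of_nat n) sums Ln (1 - z)"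
    using Ln_series'[of "- z"] z by simp
  then have "(\<lambda>n. 2 * Re (- (z ^ n) / of_nat n)) sums (2 * Re (Ln (1 - z)))"
    by (intro sums_mult sums_Re)
  moreover have "2 * Re (- (z ^ n) / of_nat n) = - 2 * a ^ n / real n * cos (real n * t)" for n
  proof -
    have "z ^ n = complex_of_real (a ^ n) * cis (real n * t)"
      by (simp add: z_def power_mult_distrib Complex.DeMoivre)
    then have "Re (z ^ n) = a ^ n * cos (real n * t)" by (simp del: of_real_power)
    then show ?thesis by (simp add: Re_divide_of_nat)
  qed
  moreover have "2 * Re (Ln (1 - z)) = ln (1 - 2 * a * cos t + a\<^sup>2)"
  proof -
    have "(cmod (1 - z))\<^sup>2 = (1 - a * cos t)\<^sup>2 + (a * sin t)\<^sup>2"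
      by (simp add: cmod_power2 z_def)
    also have "\<dots> = 1 - 2 * a * cos t + a\<^sup>2 * ((sin t)\<^sup>2 + (cos t)\<^sup>2)" by algebra
    finally have "ln ((cmod (1 - z))\<^sup>2) = ln (1 - 2 * a * cos t + a\<^sup>2)" by simp
    then show ?thesis using \<open>1 - z \<noteq> 0\<close> by (simp add: ln_realpow)
  qed
  ultimately show ?thesis by (simp only:)
qed

lemma integral_cos_even:
  "(LBINT t:{0..pi}. cos (2 * real k * t)) = (if k = 0 then pi else 0)"
proof (cases "k = 0")
  case False
  have "(LBINT t:{0..pi}. cos (2 * real k * t)) = sin (2 * real k * pi) / (2 * real k) - sin (2 * real k * 0) / (2 * real k)"
    unfolding set_lebesgue_integral_def
    by (subst integral_FTC_Icc_real[where F="\<lambda>t. sin (2 * real k * t) / (2 * real k)", symmetric])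
      (use False in \<open>auto intro!: derivative_eq_intros continuous_intros simp: mult.commute\<close>)
  also have "sin (2 * real k * pi) = 0"
    using sin_npi[of "2 * k"] by (simp add: mult.assoc)
  finally show ?thesis using False by simp
qed (simp add: set_lebesgue_integral_def)

text \<open>Integrate the cosine series of the logarithm term by term. The kernel has only the
  frequencies 0 and 1 in \<open>2 * t\<close> and the series has no constant term, so orthogonality
  leaves \<open>n = 1\<close>: the integral of \<open>4 * a * (cos (2 * t))^2\<close>.\<close>

lemma integral_log_kernel:
  fixes a :: real
  assumes a: "0 < a" "a < 1"
  shows "(LBINT t:{0..pi}. (1 / a + a - 2 * cos (2 * t)) * ln (1 - 2 * a * cos (2 * t) + a\<^sup>2)) = 2 * pi * a"
proof -
  define c where "c = 1 / a + a"
  define f where "f n t = indicator {0..pi} t *\<^sub>R ((c - 2 * cos (2 * t)) * (- 2 * a ^ n / real n * cos (real n * (2 * t))))" for n t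
  have c: "0 < c" using a by (simp add: c_def add_pos_pos)
  have cont: "continuous_on A (\<lambda>t. (c - 2 * cos (2 * t)) * (- 2 * a ^ n / real n * cos (real n * (2 * t))))" for n A
    by (intro continuous_intros)
  have int: "integrable lborel (f n)" for n
    unfolding f_def by (rule borel_integrable_atLeastAtMost'[unfolded set_integrable_def]) (rule cont)
  \<comment> \<open>A geometric majorant uniform in \<open>t\<close> yields both summability
    conditions for exchanging sum and integral.\<close>
  have bound: "norm (f n t) \<le> indicator {0..pi} t * ((c + 2) * 2 * a ^ n)" for n t
  proof (cases "n = 0")
    case False
    have "\<bar>c - 2 * cos (2 * t)\<bar> \<le> c + 2"
      using abs_cos_le_one[of "2 * t"] c by linarith
    moreover have "\<bar>- 2 * a ^ n / real n * cos (real n * (2 * t))\<bar> \<le> 2 * a ^ n"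
    proof -
      have "a ^ n / real n * \<bar>cos (real n * (2 * t))\<bar> \<le> a ^ n / 1 * 1"
        using a False by (intro mult_mono divide_left_mono) auto
      then show ?thesis using a by (simp add: abs_mult)
    qed
    ultimately have "\<bar>c - 2 * cos (2 * t)\<bar> * \<bar>- 2 * a ^ n / real n * cos (real n * (2 * t))\<bar> \<le> (c + 2) * (2 * a ^ n)"
      using c by (intro mult_mono) auto
    then have "indicator {0..pi} t * (\<bar>c - 2 * cos (2 * t)\<bar> * \<bar>- 2 * a ^ n / real n * cos (real n * (2 * t))\<bar>)
        \<le> indicator {0..pi} t * ((c + 2) * 2 * a ^ n)"
      by (intro mult_left_mono) (simp_all only: mult.assoc indicator_pos_le)
    then show ?thesis by (simp only: f_def real_scaleR_def real_norm_def abs_mult abs_indicator)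
  qed (use c in \<open>auto simp: f_def split: split_indicator\<close>)
  have geo: "summable (\<lambda>n. C * a ^ n)" for C
    using a by (intro summable_mult summable_geometric) auto
  have "(\<lambda>n. integral\<^sup>L lborel (f n)) sums (\<integral>t. (\<Sum>n. f n t) \<partial>lborel)"
  proof (rule sums_integral[OF int])
    show "AE t in lborel. summable (\<lambda>n. norm (f n t))"
    proof (intro AE_I2)
      fix t show "summable (\<lambda>n. norm (f n t))"
        by (rule summable_comparison_test'[OF geo[of "indicator {0..pi} t * ((c + 2) * 2)"]])
          (use bound[of _ t] in \<open>simp add: mult.assoc\<close>)
    qed
    show "summable (\<lambda>n. \<integral>t. norm (f n t) \<partial>lborel)"
    proof (rule summable_comparison_test'[OF geo[of "pi * ((c + 2) * 2)"]])
      fix n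
      have "(\<integral>t. norm (f n t) \<partial>lborel) \<le> (\<integral>t. indicator {0..pi} t * ((c + 2) * 2 * a ^ n) \<partial>lborel)"
        using int bound by (intro integral_mono) auto
      then show "norm (\<integral>t. norm (f n t) \<partial>lborel) \<le> pi * ((c + 2) * 2) * a ^ n"
        by (simp add: mult.assoc)
    qed
  qed
  moreover have "(\<Sum>n. f n t) = indicator {0..pi} t *\<^sub>R ((c - 2 * cos (2 * t)) * ln (1 - 2 * a * cos (2 * t) + a\<^sup>2))" for t
    unfolding f_def
    by (intro sums_unique[symmetric] sums_scaleR_right sums_mult ln_one_minus_cos_sums) (use a in auto)
  moreover have "integral\<^sup>L lborel (f n) = (if n = 1 then 2 * pi * a else 0)" for n
  proof (cases n)
    case (Suc k)
    \<comment> \<open>The product has frequencies \<open>n + 1\<close> and \<open>n - 1 = k\<close>;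
      only \<open>k = 0\<close> gives a nonzero integral.\<close>
    have cos3: "2 * cos (2 * t) * cos (real n * (2 * t)) = cos (2 * real (Suc n) * t) + cos (2 * real k * t)" for t
    proof -
      have "2 * real (Suc n) * t = real n * (2 * t) + 2 * t" "2 * real k * t = real n * (2 * t) - 2 * t"
        by (simp_all add: Suc algebra_simps)
      then show ?thesis by (simp only: cos_add cos_diff) simp
    qed
    have "f n t = indicator {0..pi} t * (- 2 * a ^ n / real n * c * cos (2 * real n * t)
        + 2 * a ^ n / real n * cos (2 * real (Suc n) * t) + 2 * a ^ n / real n * cos (2 * real k * t))" for t
    proof -
      have "(c - 2 * cos (2 * t)) * (- K * C) = - K * c * C + K * (2 * cos (2 * t) * C)" for K C
        by (simp add: algebra_simps)
      moreover have e: "cos (2 * real n * t) = cos (real n * (2 * t))"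
        by (rule arg_cong[of _ _ cos]) simp
      note calculation[of "2 * a ^ n / real n" "cos (real n * (2 * t))"]
      ultimately have "(c - 2 * cos (2 * t)) * (- 2 * a ^ n / real n * cos (real n * (2 * t)))
        = - 2 * a ^ n / real n * c * cos (2 * real n * t) + 2 * a ^ n / real n * (2 * cos (2 * t) * cos (real n * (2 * t)))"
        by (simp only: e minus_mult_left minus_divide_left)
      then show ?thesis unfolding cos3 by (simp add: f_def distrib_left algebra_simps)
    qed
    then have "integral\<^sup>L lborel (f n) = (LBINT t:{0..pi}. - 2 * a ^ n / real n * c * cos (2 * real n * t)
        + 2 * a ^ n / real n * cos (2 * real (Suc n) * t) + 2 * a ^ n / real n * cos (2 * real k * t))"
      unfolding set_lebesgue_integral_def real_scaleR_def by (intro Bochner_Integration.integral_cong refl)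
    moreover have "set_integrable lborel {0..pi} (\<lambda>t. b * cos (2 * real m * t))" for b m
      by (intro borel_integrable_atLeastAtMost' continuous_intros)
    ultimately have "integral\<^sup>L lborel (f n) = - 2 * a ^ n / real n * c * (LBINT t:{0..pi}. cos (2 * real n * t))
        + 2 * a ^ n / real n * (LBINT t:{0..pi}. cos (2 * real (Suc n) * t))
        + 2 * a ^ n / real n * (LBINT t:{0..pi}. cos (2 * real k * t))"
      by (simp only: set_integral_add set_integral_mult_right)
    then show ?thesis unfolding integral_cos_even using Suc by simp
  qed (simp add: f_def[abs_def])
  ultimately have "(\<lambda>n. if n = 1 then 2 * pi * a else 0) sums (LBINT t:{0..pi}. (c - 2 * cos (2 * t)) * ln (1 - 2 * a * cos (2 * t) + a\<^sup>2))"
    by (simp add: set_lebesgue_integral_def)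
  moreover have "(\<lambda>n. if n = 1 then 2 * pi * a else 0) sums (2 * pi * a)"
    using sums_single[of 1 "\<lambda>_. 2 * pi * a"] by simp
  ultimately show ?thesis unfolding c_def by (rule sums_unique2)
qed

text \<open>An antiderivative of \<open>c * ln (e + c * t)\<close> is
  \<open>(e + c * t) * ln (e + c * t) - c * t\<close>. Keeping the factor \<open>c\<close> on the
  left avoids a division and includes \<open>c = 0\<close>.\<close>

lemma integral_ln_affine:
  fixes e c :: real
  assumes e: "0 < e" and c: "0 \<le> c"
  shows "c * (LBINT t:{0..1}. ln (e + c * t)) = (e + c) * ln (e + c) - e * ln e - c"
proof -
  have pos: "0 < e + c * t" if "0 \<le> t" for t using e c that by (simp add: add_pos_nonneg)
  have "((\<lambda>t. (e + c * t) * ln (e + c * t) - c * t) has_real_derivative c * ln (e + c * t)) (at t)" if "0 \<le> t" for t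
    using pos[OF that] by (auto intro!: derivative_eq_intros)
  then have "(\<integral>t. c * ln (e + c * t) * indicator {0..1} t \<partial>lborel)
      = ((e + c * 1) * ln (e + c * 1) - c * 1) - ((e + c * 0) * ln (e + c * 0) - c * 0)"
    using pos[THEN less_imp_neq] by (intro integral_FTC_Icc_real) (force intro!: continuous_intros)+
  then have "(LBINT t:{0..1}. c * ln (e + c * t)) = (e + c) * ln (e + c) - e * ln e - c"
    unfolding set_lebesgue_integral_def by (simp add: mult.commute)
  then show ?thesis by (simp only: set_integral_mult_right)
qed

subsection \<open>Expectation of the logarithm\<close>

interpretation sphere: prob_space sphere_haar
  by (rule prob_space_sphere_haar)

interpretation torus: pair_prob_space sphere_haar sphere_haar ..

lemma sets_torus_haar [measurable_cong]: "sets torus_haar = sets (borel \<Otimes>\<^sub>M borel)"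
  unfolding torus_haar_def by (intro sets_pair_measure_cong) simp_all

lemma AE_torus_haar:
  assumes "Measurable.pred (borel \<Otimes>\<^sub>M borel) P" "AE x in sphere_haar. AE y in sphere_haar. P (x, y)"
  shows "AE p in torus_haar. P p"
  unfolding torus_haar_def
proof (rule torus.AE_pair_measure)
  have "{p \<in> space (borel \<Otimes>\<^sub>M borel). P p} \<in> sets (borel \<Otimes>\<^sub>M borel)"
    using assms(1) by (rule predE)
  then show "{p \<in> space (sphere_haar \<Otimes>\<^sub>M sphere_haar). P p} \<in> sets (sphere_haar \<Otimes>\<^sub>M sphere_haar)"
    using sets_torus_haar by (simp add: torus_haar_def space_pair_measure)
qed (fact assms)

lemma commutator_sq_nonneg: "0 \<le> commutator_sq x y"
  by (simp add: commutator_sq_def)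

text \<open>This confines the logarithm of \<open>e\<close> plus the squared commutator to the
  interval from \<open>ln e\<close> to \<open>ln (e + 4)\<close>, which makes it integrable.\<close>

lemma AE_commutator_sq_le: "AE p in torus_haar. commutator_sq (fst p) (snd p) \<le> 4"
proof (rule AE_torus_haar)
  have imag: "imag_sq x \<le> 1" if "norm x = 1" for x
    using norm_quat_sq[of x] that by (simp add: imag_sq_def) (smt (verit) zero_le_power2)
  have "commutator_sq x y \<le> 4" if "norm x = 1" "norm y = 1" for x y
  proof -
    have "imag_sq x * imag_sq y \<le> 1 * 1"
      using that by (intro mult_mono imag) (simp_all add: imag_sq_def)
    then show ?thesis unfolding commutator_sq_eq by (smt (verit) zero_le_power2)
  qed
  then show "AE x in sphere_haar. AE y in sphere_haar. commutator_sq (fst (x, y)) (snd (x, y)) \<le> 4"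
    by (intro eventually_mono[OF AE_sphere_haar_norm]) simp
qed measurable

text \<open>Almost surely \<open>imag_sq x\<close> is nonzero, and then the commutator square has
  the law of a nonzero multiple of a uniform variable. Zeros must be excluded for the limit
  \<open>e\<close> to 0, since \<open>ln 0 = 0\<close> is not the limit of
  \<open>ln e\<close>.\<close>

lemma AE_commutator_sq_nonzero: "AE p in torus_haar. commutator_sq (fst p) (snd p) \<noteq> 0"
proof (rule AE_torus_haar)
  \<comment> \<open>The density of \<open>t\<close> is itself a multiple of
    \<open>(sin t)^2\<close>, so it vanishes wherever the value does.\<close>
  have "AE s in distr sphere_haar borel imag_sq. s \<noteq> 0"
    unfolding imag_sq_law by (subst AE_distr_iff) (auto simp: AE_density split: split_indicator)
  then have 1: "AE x in sphere_haar. imag_sq x \<noteq> 0"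
    by (subst (asm) AE_distr_iff) auto
  have 2: "AE y in sphere_haar. commutator_sq x y \<noteq> 0" if x: "imag_sq x \<noteq> 0" for x
  proof -
    have "AE t in uniform_measure lborel {0..1::real}. t \<noteq> 0"
      by (rule AE_uniform_measureI) (use AE_lborel_singleton[of "0::real"] in auto)
    then have "AE w in distr sphere_haar borel (commutator_sq x). w \<noteq> 0"
      unfolding commutator_sq_law using x by (subst AE_distr_iff) auto
    then show ?thesis by (subst (asm) AE_distr_iff) auto
  qed
  show "AE x in sphere_haar. AE y in sphere_haar. commutator_sq (fst (x, y)) (snd (x, y)) \<noteq> 0"
    using 1 by eventually_elim (simp add: 2)
qed measurable

section \<open>Integration against the two laws\<close>

lemma uniform_unit_interval:
  "uniform_measure lborel {0..1::real} = density lborel (\<lambda>t. ennreal (indicator {0..1} t))"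
  by (auto simp: uniform_measure_def ennreal_indicator intro!: arg_cong[of _ _ "density lborel"] split: split_indicator)

lemma integrable_ln_commutator_sq:
  assumes e: "0 < e"
  shows "integrable torus_haar (\<lambda>p. ln (e + commutator_sq (fst p) (snd p)))"
proof -
  interpret T: prob_space torus_haar
    unfolding torus_haar_def by (rule torus.prob_space_axioms)
  show ?thesis
  proof (rule T.integrable_const_bound)
    show "AE p in torus_haar. norm (ln (e + commutator_sq (fst p) (snd p))) \<le> max \<bar>ln e\<bar> \<bar>ln (e + 4)\<bar>"
      using AE_commutator_sq_le
    proof eventually_elim
      case (elim p)
      then have "ln e \<le> ln (e + commutator_sq (fst p) (snd p))" "ln (e + commutator_sq (fst p) (snd p)) \<le> ln (e + 4)"
        using e commutator_sq_nonneg[of "fst p" "snd p"] by auto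
      then show ?case by auto
    qed
  qed measurable
qed

lemma integral_ln_commutator_sq:
  assumes e: "0 < e"
  shows "(\<integral>p. ln (e + commutator_sq (fst p) (snd p)) \<partial>torus_haar)
    = (LBINT t:{0..pi}. (e + 4 * (sin t)\<^sup>2) * ln (e + 4 * (sin t)\<^sup>2) - e * ln e - 4 * (sin t)\<^sup>2) / (2 * pi)"
proof -
  define G where "G s = (LBINT t:{0..1}. ln (e + 4 * s * t))" for s
  have [measurable]: "G \<in> borel_measurable borel"
    unfolding G_def set_lebesgue_integral_def by measurable
  have inner: "(\<integral>y. ln (e + commutator_sq x y) \<partial>sphere_haar) = G (imag_sq x)" for x
  proof -
    have "(\<integral>y. ln (e + commutator_sq x y) \<partial>sphere_haar)
        = (\<integral>w. ln (e + w) \<partial>distr sphere_haar borel (commutator_sq x))"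
      by (subst integral_distr) auto
    also have "\<dots> = (\<integral>t. ln (e + 4 * imag_sq x * t) \<partial>uniform_measure lborel {0..1})"
      unfolding commutator_sq_law by (subst integral_distr) auto
    also have "\<dots> = G (imag_sq x)"
      unfolding uniform_unit_interval G_def set_lebesgue_integral_def
      by (subst integral_density) auto
    finally show ?thesis .
  qed
  have "(\<integral>p. ln (e + commutator_sq (fst p) (snd p)) \<partial>torus_haar)
      = (\<integral>x. \<integral>y. ln (e + commutator_sq x y) \<partial>sphere_haar \<partial>sphere_haar)"
    using torus.integral_fst'[OF integrable_ln_commutator_sq[OF e, unfolded torus_haar_def]]
    by (simp add: torus_haar_def)
  also have "\<dots> = (\<integral>s. G s \<partial>distr sphere_haar borel imag_sq)"
    by (subst integral_distr) (auto simp: inner)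
  also have "\<dots> = (\<integral>t. G ((sin t)\<^sup>2) \<partial>density lborel (\<lambda>t. ennreal (2 / pi * (sin t)\<^sup>2 * indicator {0..pi} t)))"
    unfolding imag_sq_law by (subst integral_distr) auto
  also have "\<dots> = (\<integral>t. (2 / pi * (sin t)\<^sup>2 * indicator {0..pi} t) * G ((sin t)\<^sup>2) \<partial>lborel)"
    by (subst integral_density) auto
  \<comment> \<open>The weight is \<open>1 / (2 * pi)\<close> times \<open>4 * (sin t)^2\<close>,
    precisely the factor \<open>c\<close> on the left of \<open>integral_ln_affine\<close>.\<close>
  also have "\<dots> = (\<integral>t. (1 / (2 * pi)) * (indicator {0..pi} t * ((e + 4 * (sin t)\<^sup>2) * ln (e + 4 * (sin t)\<^sup>2) - e * ln e - 4 * (sin t)\<^sup>2)) \<partial>lborel)"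
  proof (intro Bochner_Integration.integral_cong refl)
    fix t
    show "(2 / pi * (sin t)\<^sup>2 * indicator {0..pi} t) * G ((sin t)\<^sup>2)
      = (1 / (2 * pi)) * (indicator {0..pi} t * ((e + 4 * (sin t)\<^sup>2) * ln (e + 4 * (sin t)\<^sup>2) - e * ln e - 4 * (sin t)\<^sup>2))"
      unfolding integral_ln_affine[OF e, of "4 * (sin t)\<^sup>2", simplified, symmetric] G_def by simp
  qed
  finally show ?thesis by (simp add: set_lebesgue_integral_def)
qed

text \<open>Split \<open>ln (K t)\<close> as \<open>ln (a * K t) - ln a\<close>. The first part is
  \<open>integral_log_kernel\<close>; the rest is a constant plus a multiple of
  \<open>cos (2 * t)\<close>, which integrates to 0.\<close>

lemma integral_ln_commutator_sq_closed_form: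
  fixes a :: real
  assumes a: "0 < a" "a < 1"
  defines "e \<equiv> (1 - a)\<^sup>2 / a"
  shows "(\<integral>p. ln (e + commutator_sq (fst p) (snd p)) \<partial>torus_haar)
    = (2 * a - (1 / a + a) * ln a - e * ln e - 2) / 2"
proof -
  define K where "K t = 1 / a + a - 2 * cos (2 * t)" for t
  have e: "0 < e" using a by (simp add: e_def)
  have K: "e + 4 * (sin t)\<^sup>2 = K t" for t
  proof -
    have "cos (2 * t) = 1 - 2 * (sin t)\<^sup>2" by (simp add: cos_double_sin)
    then show ?thesis unfolding e_def K_def using a by (simp only:) (simp add: power2_diff field_simps power2_eq_square)
  qed
  have Kpos: "0 < K t" for t using e by (simp add: K[symmetric] add_pos_nonneg)
  have aK: "1 - 2 * a * cos (2 * t) + a\<^sup>2 = a * K t" for t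
    using a by (simp add: K_def field_simps power2_eq_square)
  have lnK: "ln (K t) = ln (1 - 2 * a * cos (2 * t) + a\<^sup>2) - ln a" for t
    unfolding aK using a Kpos[of t] by (simp add: ln_mult)
  have pos: "1 - 2 * a * cos (2 * t) + a\<^sup>2 \<noteq> 0" for t
    unfolding aK using a Kpos[of t] by (metis less_irrefl mult_eq_0_iff)
  have cos2: "(LBINT t:{0..pi}. cos (2 * t)) = 0" using integral_cos_even[of 1] by simp
  have const: "(LBINT t:{0..pi}. b) = pi * b" for b :: real
    by (simp add: set_lebesgue_integral_def)
  have int: "set_integrable lborel {0..pi} (\<lambda>t. K t * ln (1 - 2 * a * cos (2 * t) + a\<^sup>2))"
      "set_integrable lborel {0..pi} (\<lambda>t. b)" "set_integrable lborel {0..pi} (\<lambda>t. b * cos (2 * t))" for b :: real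
    unfolding K_def by (intro borel_integrable_atLeastAtMost' continuous_intros pos ballI)+
  have "(e + 4 * (sin t)\<^sup>2) * ln (e + 4 * (sin t)\<^sup>2) - e * ln e - 4 * (sin t)\<^sup>2
      = K t * ln (1 - 2 * a * cos (2 * t) + a\<^sup>2) + (- (1 / a + a) * ln a - e * ln e - 2) + (2 * ln a + 2) * cos (2 * t)" for t
  proof -
    have "4 * (sin t)\<^sup>2 = 2 - 2 * cos (2 * t)" by (simp add: cos_double_sin)
    then have "(e + 4 * (sin t)\<^sup>2) * ln (e + 4 * (sin t)\<^sup>2) - e * ln e - 4 * (sin t)\<^sup>2
        = K t * ln (1 - 2 * a * cos (2 * t) + a\<^sup>2) - K t * ln a - e * ln e - (2 - 2 * cos (2 * t))"
      unfolding K lnK by (simp add: right_diff_distrib)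
    also have "K t * ln a = (1 / a + a) * ln a - 2 * cos (2 * t) * ln a"
      unfolding K_def by (simp only: left_diff_distrib)
    finally show ?thesis by (simp add: algebra_simps)
  qed
  then have "(LBINT t:{0..pi}. (e + 4 * (sin t)\<^sup>2) * ln (e + 4 * (sin t)\<^sup>2) - e * ln e - 4 * (sin t)\<^sup>2)
      = (LBINT t:{0..pi}. K t * ln (1 - 2 * a * cos (2 * t) + a\<^sup>2)) + pi * (- (1 / a + a) * ln a - e * ln e - 2)"
    using int by (simp only: set_integral_add set_integral_mult_right const cos2)
  also have "(LBINT t:{0..pi}. K t * ln (1 - 2 * a * cos (2 * t) + a\<^sup>2)) = 2 * pi * a"
    unfolding K_def by (rule integral_log_kernel[OF a])
  finally have "(LBINT t:{0..pi}. (e + 4 * (sin t)\<^sup>2) * ln (e + 4 * (sin t)\<^sup>2) - e * ln e - 4 * (sin t)\<^sup>2)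
      = pi * (2 * a - (1 / a + a) * ln a - e * ln e - 2)"
    by (simp add: algebra_simps)
  then show ?thesis by (simp add: integral_ln_commutator_sq[OF e])
qed

section \<open>The two Mahler measures\<close>

lemma ln_norm_commutator:
  "ln (norm (qmult x y - qmult y x)) = ln (commutator_sq x y) / 2"
  \<comment> \<open>For commuting \<open>x\<close> and \<open>y\<close> both sides are 0 because
    \<open>ln 0 = 0\<close>.\<close>
  by (cases "norm (qmult x y - qmult y x) = 0") (auto simp: commutator_sq_def ln_realpow)

lemma ln_norm_commutator_plus_one:
  "ln (norm (qmult x y - qmult y x + qone)) = ln (1 + commutator_sq x y) / 2"
proof -
  have "norm (qmult x y - qmult y x + qone) \<noteq> 0"
    using norm_commutator_plus_one_sq[of x y] commutator_sq_nonneg[of x y] by auto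
  then show ?thesis
    by (simp add: norm_commutator_plus_one_sq[symmetric] ln_realpow)
qed

lemma has_bochner_integral_ln_commutator_sq:
  "has_bochner_integral torus_haar (\<lambda>p. ln (commutator_sq (fst p) (snd p))) 0"
proof -
  let ?W = "\<lambda>p. commutator_sq (fst p) (snd p)"
  \<comment> \<open>The shift by 2 keeps \<open>a n\<close> strictly between 0 and 1 from
    \<open>n = 0\<close> on, and \<open>e n\<close> decreases to 0.\<close>
  define a :: "nat \<Rightarrow> real" where "a n = 1 - 1 / (real n + 2)" for n
  define e where "e n = (1 - a n)\<^sup>2 / a n" for n
  have a: "0 < a n" "a n < 1" for n by (simp_all add: a_def field_simps)
  have e_eq: "e n = 1 / ((real n + 1) * (real n + 2))" for n
    by (simp add: e_def a_def divide_simps power2_eq_square) 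
  have e: "0 < e n" for n by (simp add: e_eq)
  have e_mono: "e n \<le> e m" if "m \<le> n" for m n
    unfolding e_eq using that by (intro divide_left_mono mult_mono) auto
  have e_lim: "e \<longlonglongrightarrow> 0"
    unfolding e_eq[abs_def] by real_asymp
  \<comment> \<open>The sign makes the approximations increase, and monotone convergence delivers
    integrability together with the value.\<close>
  have "has_bochner_integral torus_haar (\<lambda>p. - ln (?W p)) 0"
  proof (rule has_bochner_integral_monotone_convergence)
    show "integrable torus_haar (\<lambda>p. - ln (e n + ?W p))" for n
      using integrable_ln_commutator_sq[OF e] by simp
    show "AE p in torus_haar. mono (\<lambda>n. - ln (e n + ?W p))"
    proof (intro AE_I2 monoI)
      fix p and m n :: nat assume "m \<le> n"
      then show "- ln (e m + ?W p) \<le> - ln (e n + ?W p)"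
        using e_mono[of m n] e[of n] commutator_sq_nonneg[of "fst p" "snd p"] by simp
    qed
    show "AE p in torus_haar. (\<lambda>n. - ln (e n + ?W p)) \<longlonglongrightarrow> - ln (?W p)"
      using AE_commutator_sq_nonzero
    proof eventually_elim
      case (elim p)
      have "(\<lambda>n. e n + ?W p) \<longlonglongrightarrow> 0 + ?W p" by (intro tendsto_intros e_lim)
      then show ?case using elim by (intro tendsto_minus tendsto_ln) auto
    qed
    \<comment> \<open>Both logarithmic terms tend to 0, and \<open>2 * a n - 2\<close> does
      too.\<close>
    have "(\<lambda>n. - ((2 * a n - (1 / a n + a n) * ln (a n) - e n * ln (e n) - 2) / 2)) \<longlonglongrightarrow> 0"
      unfolding e_eq a_def by real_asymp
    then show "(\<lambda>n. \<integral>p. - ln (e n + ?W p) \<partial>torus_haar) \<longlonglongrightarrow> 0"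
      by (simp only: integral_ln_commutator_sq_closed_form[OF a, folded e_def] Bochner_Integration.integral_minus)
  qed measurable
  then show ?thesis using has_bochner_integral_minus by fastforce
qed

theorem theorem7p3:
  shows "mahler_H_integrable (\<lambda>x y. qmult x y - qmult y x)
    \<and> mahler_H (\<lambda>x y. qmult x y - qmult y x) = 0
    \<and> mahler_H_integrable (\<lambda>x y. qmult x y - qmult y x + qone)
    \<and> mahler_H (\<lambda>x y. qmult x y - qmult y x + qone)
        = (1 - sqrt 5 + 3 * ln ((3 + sqrt 5) / 2)) / 4"
proof -
  \<comment> \<open>This is the root in \<open>(0, 1)\<close> of \<open>(1 - a)^2 = a\<close>, which
    makes \<open>e = 1\<close>. Then \<open>e * ln e = 0\<close> and
    \<open>2 * a - 2 = 1 - sqrt 5\<close>.\<close>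
  define a where "a = (3 - sqrt 5) / 2"
  have "sqrt 5 < 3" "1 < sqrt 5" by (auto intro: real_less_lsqrt real_less_rsqrt)
  then have a: "0 < a" "a < 1" by (simp_all add: a_def)
  have inv: "1 / a = (3 + sqrt 5) / 2"
    using a by (simp add: a_def field_simps)
  have "1 / a + a = 3" unfolding inv by (simp add: a_def field_simps)
  moreover have "(1 - a)\<^sup>2 / a = 1 / a + a - 2"
    using a by (simp add: power2_eq_square field_simps)
  moreover have "ln a = - ln ((3 + sqrt 5) / 2)"
    using a by (simp add: inv[symmetric] ln_div)
  ultimately have "(\<integral>p. ln (1 + commutator_sq (fst p) (snd p)) \<partial>torus_haar)
      = (1 - sqrt 5 + 3 * ln ((3 + sqrt 5) / 2)) / 2"
    using integral_ln_commutator_sq_closed_form[OF a] by (simp add: a_def)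
  then show ?thesis
    using has_bochner_integral_ln_commutator_sq integrable_ln_commutator_sq[of 1]
    by (simp add: mahler_H_def mahler_H_integrable_def case_prod_unfold ln_norm_commutator
      ln_norm_commutator_plus_one has_bochner_integral_iff)
qed

end
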